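(* For every positive integer $n$ we have $g_5(n) < 1.2 \cdot 10^8$. That is, for every $n \ge 1$ and every set $A \subseteq \{1, 2, \ldots, 2n\}$ with $|A| \ge n + 1.2\cdot 10^8$, there exist pairwise distinct integers $b_1, \ldots, b_5$ with $b_i + b_j \in A$ for all $1 \le i < j \le 5$.
   Context: For positive integers $n$ and $k \ge 3$, $g_k(n)$ denotes the smallest integer such that for every set $A \subseteq \{1, 2, \ldots, 2n\}$ with $|A| \ge n + g_k(n)$ there exist pairwise distinct integers $b_1, \ldots, b_k$ (arbitrary integers, not required to be positive or to lie in $A$) with $b_i + b_j \in A$ for all $1 \le i < j \le k$. *)

theory Defs
  imports Complex_Main
begin

definition contains_pairwise_sums :: "nat \<Rightarrow> int set \<Rightarrow> bool" where
  "contains_pairwise_sums k A \<longleftrightarrow>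
     (\<exists>b :: nat \<Rightarrow> int. inj_on b {1..k} \<and>
        (\<forall>i \<in> {1..k}. \<forall>j \<in> {1..k}. i < j \<longrightarrow> b i + b j \<in> A))"

definition sums_threshold :: "nat \<Rightarrow> nat \<Rightarrow> int \<Rightarrow> bool" where
  "sums_threshold k n m \<longleftrightarrow>
     (\<forall>A \<subseteq> {1..2 * int n}. int (card A) \<ge> int n + m \<longrightarrow> contains_pairwise_sums k A)"

(* LEAST over the integers is only meaningful when a least element exists;
   see g_sums_least below. *)
definition g_sums :: "nat \<Rightarrow> nat \<Rightarrow> int" where
  "g_sums k n = (LEAST m. sums_threshold k n m)"

lemma g_sums_least:
  assumes "k \<ge> 2"
  shows "sums_threshold k n (g_sums k n)"
    and "sums_threshold k n m \<Longrightarrow> g_sums k n \<le> m"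
proof -
  define P where "P = sums_threshold k n"
  have lower: "- int n < m" if "P m" for m
  proof (rule ccontr)
    assume "\<not> - int n < m"
    then have "contains_pairwise_sums k {}"
      using that unfolding P_def sums_threshold_def by auto
    then show False
      using assms unfolding contains_pairwise_sums_def by force
  qed
  have upper: "P (int n + 1)"
    unfolding P_def sums_threshold_def
  proof (intro allI impI)
    fix A assume A: "A \<subseteq> {1..2 * int n}" and c: "int n + (int n + 1) \<le> int (card A)"
    have "card A \<le> card {1..2 * int n}"
      using A by (intro card_mono) auto
    with c show "contains_pairwise_sums k A" by simp
  qed
  define t where "t = (LEAST t :: nat. P (int t - int n))"
  have "P (int (2 * n + 1) - int n)"
    using upper by (simp add: algebra_simps)
  then have t1: "P (int t - int n)"
    unfolding t_def by (rule LeastI)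
  have t2: "int t - int n \<le> m" if "P m" for m
  proof -
    have "P (int (nat (m + int n)) - int n)"
      using that lower[OF that] by simp
    then have "t \<le> nat (m + int n)"
      unfolding t_def by (rule Least_le)
    with lower[OF that] show ?thesis by linarith
  qed
  have g: "g_sums k n = int t - int n"
    using t1 t2 unfolding g_sums_def P_def by (intro Least_equality)
  show "sums_threshold k n (g_sums k n)"
    using t1 g by (simp add: P_def)
  show "g_sums k n \<le> m" if "sums_threshold k n m"
    using t2 that g by (simp add: P_def)
qed

end

(* Let E(m) be the number of evens of A in [1, 2m] and t(m) the number of odds missing there.
   Passing to a shortest block with large excess E - t, we may assume t < E on every prefix and
   every suffix; by reflection, half of the evens lie in the lower half of the block.  If some
   prefix has E(m) >= 0.24 m, a Hilbert cube of dimension 4 inside the evens gives five numbers.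
   If m/40 <= E(m) < 0.24 m, four numbers with even sums exist in a short interval, and as
   t(m) < 0.24 m some fifth number of the opposite parity misses all gaps.  If every long prefix
   has E(m) < m/40, take the last three evens 2Y < 2Z < 2Z' of the lower half: for one of the pairs
   (Y, Z), (Z, Z'), or because Z' > 2Z > 4Y leaves no further evens nearby, there are so few gaps
   that three numbers with sums 2, 2Y, 2Z extend by two numbers of the opposite parity. *)

theory Submission
  imports Defs
begin

section \<open>Halved even part and odd gaps\<close>

definition even_part :: "int set \<Rightarrow> int \<Rightarrow> int set" where
  "even_part A m = {e \<in> {1..m}. 2 * e \<in> A}"

text \<open>Index \<open>k\<close> pairs the odd number \<open>2 * k - 1\<close> with the even
  number \<open>2 * k\<close>. The lower end is a parameter because the induction counts gaps from
  1, while the prefix argument, applied also to reflected sets, counts them from 2.\<close>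

definition odd_gaps :: "int set \<Rightarrow> int \<Rightarrow> int \<Rightarrow> int set" where
  "odd_gaps A l m = {k \<in> {l..m}. 2 * k - 1 \<notin> A}"

lemma even_part_subset: "even_part A m \<subseteq> {1..m}"
  and odd_gaps_subset: "odd_gaps A l m \<subseteq> {l..m}"
  by (auto simp: even_part_def odd_gaps_def)

lemma finite_even_part [simp]: "finite (even_part A m)"
  and finite_odd_gaps [simp]: "finite (odd_gaps A l m)"
  by (rule finite_subset[OF even_part_subset], simp) (rule finite_subset[OF odd_gaps_subset], simp)

lemma finite_bounded_Collect [simp]: "finite {e :: int. a \<le> e \<and> e \<le> b \<and> P e}"
  by (rule finite_subset[of _ "{a..b}"]) auto

section \<open>Pairwise sums under translation and reflection\<close>

lemma contains_pairwise_sums_5I: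
  fixes b1 b2 b3 b4 b5 :: int
  assumes "distinct [b1, b2, b3, b4, b5]"
    and "b1 + b2 \<in> A" "b1 + b3 \<in> A" "b1 + b4 \<in> A" "b1 + b5 \<in> A" "b2 + b3 \<in> A"
    and "b2 + b4 \<in> A" "b2 + b5 \<in> A" "b3 + b4 \<in> A" "b3 + b5 \<in> A" "b4 + b5 \<in> A"
  shows "contains_pairwise_sums 5 A"
proof -
  define b where "b i = [b1, b2, b3, b4, b5] ! (i - 1)" for i :: nat
  have I: "{1..5} = {1, 2, 3, 4, 5 :: nat}" by auto
  have b: "b 1 = b1" "b (Suc 0) = b1" "b 2 = b2" "b 3 = b3" "b 4 = b4" "b 5 = b5"
    by (simp_all add: b_def eval_nat_numeral)
  have "inj_on b {1..5}" unfolding I using assms(1) by (auto simp: inj_on_def b)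
  moreover have "\<forall>i\<in>{1..5}. \<forall>j\<in>{1..5}. i < j \<longrightarrow> b i + b j \<in> A"
    unfolding I using assms(2-) by (simp add: b)
  ultimately show ?thesis unfolding contains_pairwise_sums_def by blast
qed

text \<open>Adding \<open>c\<close> to every \<open>b i\<close> moves all sums by
  \<open>2 * c\<close>. The even shift keeps parities, so a suffix can be treated as a block
  starting at 1.\<close>

lemma contains_pairwise_sums_translate:
  assumes "contains_pairwise_sums k {a. a + 2 * c \<in> A}"
  shows "contains_pairwise_sums k A"
proof -
  obtain b where b: "inj_on b {1..k}"
    "\<forall>i\<in>{1..k}. \<forall>j\<in>{1..k}. i < j \<longrightarrow> b i + b j + 2 * c \<in> A"
    using assms unfolding contains_pairwise_sums_def mem_Collect_eq by (elim exE conjE)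
  have "inj_on (\<lambda>i. b i + c) {1..k}"
    by (rule inj_onI) (rule inj_onD[OF b(1)], simp_all)
  moreover have "\<forall>i\<in>{1..k}. \<forall>j\<in>{1..k}. i < j \<longrightarrow> (b i + c) + (b j + c) \<in> A"
  proof (intro ballI impI)
    fix i j assume "i \<in> {1..k}" "j \<in> {1..k}" "i < j"
    then have "b i + b j + 2 * c \<in> A" using b(2) by blast
    also have "b i + b j + 2 * c = (b i + c) + (b j + c)" by simp
    finally show "(b i + c) + (b j + c) \<in> A" .
  qed
  ultimately show ?thesis
    unfolding contains_pairwise_sums_def by (intro exI[of _ "\<lambda>i. b i + c"] conjI)
qed

text \<open>The substitution \<open>c - b i\<close> reflects all sums and keeps their parity; this
  exchanges the two halves of a block.\<close>

lemma contains_pairwise_sums_reflect: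
  assumes "contains_pairwise_sums k {a. 2 * c - a \<in> A}"
  shows "contains_pairwise_sums k A"
proof -
  obtain b where b: "inj_on b {1..k}"
    "\<forall>i\<in>{1..k}. \<forall>j\<in>{1..k}. i < j \<longrightarrow> 2 * c - (b i + b j) \<in> A"
    using assms unfolding contains_pairwise_sums_def mem_Collect_eq by (elim exE conjE)
  have "inj_on (\<lambda>i. c - b i) {1..k}"
    by (rule inj_onI) (rule inj_onD[OF b(1)], simp_all)
  moreover have "\<forall>i\<in>{1..k}. \<forall>j\<in>{1..k}. i < j \<longrightarrow> (c - b i) + (c - b j) \<in> A"
  proof (intro ballI impI)
    fix i j assume "i \<in> {1..k}" "j \<in> {1..k}" "i < j"
    then have "2 * c - (b i + b j) \<in> A" using b(2) by blast
    also have "2 * c - (b i + b j) = (c - b i) + (c - b j)" by simp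
    finally show "(c - b i) + (c - b j) \<in> A" .
  qed
  ultimately show ?thesis
    unfolding contains_pairwise_sums_def by (intro exI[of _ "\<lambda>i. c - b i"] conjI)
qed

section \<open>Counting pairs, differences and sums\<close>

lemma card_less_pairs:
  fixes B :: "'a :: linorder set"
  assumes "finite B"
  shows "2 * int (card {(u, v) \<in> B \<times> B. u < v}) = int (card B) * (int (card B) - 1)"
proof -
  let ?L = "{(u, v) \<in> B \<times> B. u < v}" and ?G = "{(u, v) \<in> B \<times> B. v < u}"
  let ?D = "(\<lambda>u. (u, u)) ` B"
  have fin: "finite ?L" "finite ?G" by (rule finite_subset[of _ "B \<times> B"], use assms in auto)+
  have "bij_betw prod.swap ?L ?G"
    by (rule bij_betw_byWitness[where f' = prod.swap]) auto
  then have LG: "card ?L = card ?G" by (rule bij_betw_same_card)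
  have D: "card ?D = card B" by (rule card_image) (auto simp: inj_on_def)
  have "B \<times> B = (?L \<union> ?G) \<union> ?D" by auto
  then have "card (B \<times> B) = card ((?L \<union> ?G) \<union> ?D)" by (rule arg_cong)
  also have "\<dots> = card (?L \<union> ?G) + card ?D"
    using fin assms by (intro card_Un_disjoint) auto
  also have "card (?L \<union> ?G) = card ?L + card ?G"
    using fin by (intro card_Un_disjoint) auto
  finally have "card B * card B = 2 * card ?L + card B"
    using LG D by (simp add: card_cartesian_product)
  then have "int (card B) * int (card B) = 2 * int (card ?L) + int (card B)"
    by (simp flip: of_nat_mult)
  then show ?thesis by (simp only: right_diff_distrib)
qed

text \<open>Union bound: by injectivity each \<open>i\<close> rules out at most
  \<open>card Q\<close> values of \<open>j\<close>.\<close>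

lemma exists_avoiding:
  assumes "finite I" "finite J" "finite Q"
    and inj: "\<And>i. i \<in> I \<Longrightarrow> inj_on (f i) J"
    and less: "card I * card Q < card J"
  shows "\<exists>j\<in>J. \<forall>i\<in>I. f i j \<notin> Q"
proof (rule ccontr)
  assume "\<not> ?thesis"
  then have "J \<subseteq> (\<Union>i\<in>I. {j \<in> J. f i j \<in> Q})" by auto
  then have "card J \<le> card (\<Union>i\<in>I. {j \<in> J. f i j \<in> Q})"
    using assms by (intro card_mono) auto
  also have "\<dots> \<le> (\<Sum>i\<in>I. card {j \<in> J. f i j \<in> Q})"
    using \<open>finite I\<close> by (rule card_UN_le)
  also have "\<dots> \<le> (\<Sum>i\<in>I. card Q)"
  proof (rule sum_mono)
    fix i assume "i \<in> I"
    then have "inj_on (f i) {j \<in> J. f i j \<in> Q}"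
      using inj by (auto simp: inj_on_def)
    then show "card {j \<in> J. f i j \<in> Q} \<le> card Q"
      by (rule card_inj_on_le) (use \<open>finite Q\<close> in auto)
  qed
  also have "\<dots> = card I * card Q" by simp
  finally show False using less by simp
qed

text \<open>Averaging: at most \<open>card F * card B\<close> of the pairs in \<open>B\<close> have
  a difference in \<open>F\<close>, and the rest share at most \<open>M\<close> differences.
  \<open>F\<close> will hold the generators already chosen, which keeps those of the cube
  distinct.\<close>

lemma exists_popular_difference:
  fixes B F :: "int set" and M :: int
  assumes B: "B \<subseteq> {1..M}" and M: "M > 0" and F: "finite F"
  shows "\<exists>h\<ge>1. h \<notin> F \<and>
    int (card B) * (int (card B) - 1 - 2 * int (card F)) \<le> 2 * M * int (card {a \<in> B. a + h \<in> B})"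
proof (rule ccontr)
  define r where "r h = card {a \<in> B. a + h \<in> B}" for h
  define X where "X = int (card B) * (int (card B) - 1 - 2 * int (card F))"
  assume "\<not> ?thesis"
  then have neg: "2 * M * int (r h) < X" if "h \<ge> 1" "h \<notin> F" for h
    using that unfolding r_def X_def by force
  have finB: "finite B" using B by (rule finite_subset) simp
  have "infinite {1::int..}" by (rule infinite_Ici)
  then have "\<not> {1..} \<subseteq> F" using F finite_subset by blast
  \<comment> \<open>Some \<open>h \<ge> 1\<close> lies outside the finite set \<open>F\<close>, and
    \<open>neg\<close> puts \<open>X\<close> above a nonnegative number.\<close>
  then have "X > 0" using neg M by (smt (verit) atLeast_iff of_nat_0_le_iff subsetI zero_le_mult_iff)
  let ?P = "{(u, v) \<in> B \<times> B. u < v}"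
  have "?P \<subseteq> (\<lambda>(h, a). (a, a + h)) ` (SIGMA h:{1..M}. {a \<in> B. a + h \<in> B})"
  proof safe
    fix u v assume "u \<in> B" "v \<in> B" "u < v"
    then show "(u, v) \<in> (\<lambda>(h, a). (a, a + h)) ` (SIGMA h:{1..M}. {a \<in> B. a + h \<in> B})"
      using B[THEN subsetD, of u] B[THEN subsetD, of v]
      by (intro image_eqI[where x = "(v - u, u)"]) auto
  qed
  then have "card ?P \<le> card (SIGMA h:{1..M}. {a \<in> B. a + h \<in> B})"
    using finB by (intro surj_card_le) auto
  also have "\<dots> = (\<Sum>h\<in>{1..M}. r h)"
    using finB by (simp add: r_def)
  also have "\<dots> = (\<Sum>h\<in>{1..M} - F. r h) + (\<Sum>h\<in>{1..M} \<inter> F. r h)"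
    using sum.Int_Diff[of "{1..M}" r F] by simp
  also have "(\<Sum>h\<in>{1..M} \<inter> F. r h) \<le> (\<Sum>h\<in>{1..M} \<inter> F. card B)"
    using finB by (intro sum_mono) (auto simp: r_def intro: card_mono)
  also have "\<dots> = card ({1..M} \<inter> F) * card B" by simp
  also have "\<dots> \<le> card F * card B"
    using F by (intro mult_right_mono card_mono) auto
  finally have "card ?P \<le> (\<Sum>h\<in>{1..M} - F. r h) + card F * card B" by simp
  then have "int (card ?P) \<le> int ((\<Sum>h\<in>{1..M} - F. r h) + card F * card B)"
    by (rule of_nat_mono)
  then have P: "X \<le> 2 * (\<Sum>h\<in>{1..M} - F. int (r h))"
    using card_less_pairs[OF finB] by (simp add: X_def algebra_simps)
  have "M * X \<le> (\<Sum>h\<in>{1..M} - F. 2 * M * int (r h))"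
    using mult_left_mono[OF P, of M] M by (simp add: sum_distrib_left algebra_simps)
  \<comment> \<open>A strict inequality of integers loses 1 in each term; with at most
    \<open>M\<close> terms this yields \<open>M * X \<le> M * (X - 1)\<close>.\<close>
  also have "\<dots> \<le> (\<Sum>h\<in>{1..M} - F. X - 1)"
    by (intro sum_mono) (use neg in force)
  also have "\<dots> = int (card ({1..M} - F)) * (X - 1)" by simp
  also have "\<dots> \<le> int (card {1..M}) * (X - 1)"
    using \<open>X > 0\<close> by (intro mult_right_mono of_nat_mono card_mono) auto
  also have "\<dots> = M * (X - 1)" using M by simp
  finally show False using M by (simp add: algebra_simps)
qed

text \<open>Pigeonhole: more than \<open>2 * (2 * L + 1)\<close> pairs have only
  \<open>2 * L + 1\<close> possible sums, so some sum occurs three times.\<close>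

lemma exists_three_representations:
  fixes D :: "int set" and a L :: int
  assumes D: "D \<subseteq> {a..a + L}" and L: "L \<ge> 0"
    and card: "int (card D) * (int (card D) - 1) > 4 * (2 * L + 1)"
  shows "\<exists>s u1 u2 u3. u1 < u2 \<and> u2 < u3 \<and> 2 * u3 < s \<and>
    {u1, u2, u3, s - u1, s - u2, s - u3} \<subseteq> D"
proof -
  have finD: "finite D" using D by (rule finite_subset) simp
  define R where "R s = {u \<in> D. s - u \<in> D \<and> 2 * u < s}" for s
  have finR: "finite (R s)" for s using finD by (simp add: R_def)
  let ?P = "{(u, v) \<in> D \<times> D. u < v}"
  have "\<exists>s. card (R s) \<ge> 3"
  proof (rule ccontr)
    assume "\<not> ?thesis"
    then have "\<not> 3 \<le> card (R s)" for s by blast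
    then have R2: "card (R s) \<le> 2" for s by (simp add: not_le less_Suc_eq_le numeral_3_eq_3 numeral_2_eq_2)
    have "?P \<subseteq> (\<lambda>(s, u). (u, s - u)) ` (SIGMA s:{2 * a..2 * a + 2 * L}. R s)"
    proof safe
      fix u v assume "u \<in> D" "v \<in> D" "u < v"
      then show "(u, v) \<in> (\<lambda>(s, u). (u, s - u)) ` (SIGMA s:{2 * a..2 * a + 2 * L}. R s)"
        using D by (intro image_eqI[where x = "(u + v, u)"]) (auto simp: R_def)
    qed
    then have "card ?P \<le> card (SIGMA s:{2 * a..2 * a + 2 * L}. R s)"
      using finR by (intro surj_card_le) auto
    also have "\<dots> = (\<Sum>s\<in>{2 * a..2 * a + 2 * L}. card (R s))"
      using finR by simp
    also have "\<dots> \<le> (\<Sum>s\<in>{2 * a..2 * a + 2 * L}. 2)"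
      by (intro sum_mono R2)
    finally have "int (card ?P) \<le> 2 * (2 * L + 1)" using L by simp
    then show False using card_less_pairs[OF finD] card by simp
  qed
  then obtain s where "card (R s) \<ge> 3" by blast
  then obtain T where T: "T \<subseteq> R s" "card T = 3"
    by (meson obtain_subset_with_card_n)
  then have finT: "finite T" using finR finite_subset by blast
  define l where "l = sorted_list_of_set T"
  have l: "length l = 3" "sorted_wrt (<) l" "set l = T"
    using T finT by (simp_all add: l_def)
  obtain u1 u2 u3 where u: "l = [u1, u2, u3]"
    using l(1) by (auto simp: numeral_3_eq_3 length_Suc_conv)
  then have "u1 < u2" "u2 < u3" "{u1, u2, u3} \<subseteq> R s" using l(2,3) T(1) by auto
  then show ?thesis unfolding R_def by blast
qed

section \<open>Five numbers from dense, medium and sparse evens\<close>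

text \<open>A Hilbert cube of dimension 4 with base \<open>2 a\<close> and generators \<open>2 h\<^sub>i\<close> contains all pairwise
  sums of \<open>a\<close> and the four numbers \<open>a + 2 h\<^sub>i\<close>.\<close>

lemma contains_pairwise_sums_dense:
  fixes M :: int
  assumes M: "M \<ge> 59999997" and dense: "100 * int (card (even_part A M)) \<ge> 24 * M"
  shows "contains_pairwise_sums 5 A"
proof -
  define B where "B = even_part A M"
  have B: "B \<subseteq> {1..M}" by (simp add: B_def even_part_subset)
  have M0: "M > 0" using M by simp
  obtain h1 where h1: "h1 \<ge> 1" and
    c1: "int (card B) * (int (card B) - 1) \<le> 2 * M * int (card {a \<in> B. a + h1 \<in> B})"
    using exists_popular_difference[OF B M0, of "{}"] by auto
  define B1 where "B1 = {a \<in> B. a + h1 \<in> B}"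
  have B1: "B1 \<subseteq> {1..M}" using B by (auto simp: B1_def)
  obtain h2 where h2: "h2 \<ge> 1" "h2 \<noteq> h1" and
    c2: "int (card B1) * (int (card B1) - 3) \<le> 2 * M * int (card {a \<in> B1. a + h2 \<in> B1})"
    using exists_popular_difference[OF B1 M0, of "{h1}"] by auto
  define B2 where "B2 = {a \<in> B1. a + h2 \<in> B1}"
  have B2: "B2 \<subseteq> {1..M}" using B1 by (auto simp: B2_def)
  obtain h3 where h3: "h3 \<ge> 1" "h3 \<noteq> h1" "h3 \<noteq> h2" and
    c3: "int (card B2) * (int (card B2) - 5) \<le> 2 * M * int (card {a \<in> B2. a + h3 \<in> B2})"
    using exists_popular_difference[OF B2 M0, of "{h1, h2}"] h2 by auto
  define B3 where "B3 = {a \<in> B2. a + h3 \<in> B2}"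
  have finB3: "finite B3" using B2 by (auto simp: B3_def intro: finite_subset)
  define x m where "x = real_of_int M" and "m = real (card B)"
  have x: "x \<ge> 59999997" using M by (simp add: x_def)
  \<comment> \<open>Each popular difference turns density \<open>c\<close> into about \<open>c\<^sup>2 / 2\<close>; after three steps about
    \<open>2 (0.24 / 2)\<^sup>8 M > 4\<close> elements remain, enough for a fourth difference distinct from the others.\<close>
  have step: "d * x \<le> real q"
    if "int p * (int p - j) \<le> 2 * M * int q" "c * x \<le> real p" "j \<le> 5" "j \<ge> 0" "c > 0.0004"
      "2 * d \<le> c * (c - 1 / 10000000)" for p q :: nat and j :: int and c d :: real
  proof -
    \<comment> \<open>The loss of \<open>1 / 10000000\<close> in density absorbs
      \<open>j \<le> 5\<close>, as \<open>x / 10000000\<close> is just below 6 at the least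
      admissible \<open>x\<close>.\<close>
    have j: "real_of_int j \<le> x / 10000000" using that(3) x by simp
    have "c * (c - 1 / 10000000) * x * x = (c * x) * (c * x - x / 10000000)"
      by (simp add: algebra_simps)
    also have "\<dots> \<le> real p * (real p - real_of_int j)"
      using that(2,5) x j by (intro mult_mono) (auto simp: algebra_simps)
    also have "\<dots> \<le> 2 * x * real q"
      using that(1) unfolding x_def by (metis (mono_tags, lifting) of_int_diff of_int_le_iff of_int_mult of_int_numeral of_int_of_nat_eq)
    finally have "c * (c - 1 / 10000000) * x \<le> 2 * real q"
      using x by (simp add: mult.commute mult.left_commute)
    moreover have "2 * d * x \<le> c * (c - 1 / 10000000) * x"
      using that(6) x by (intro mult_right_mono) auto
    ultimately show ?thesis by simp
  qed
  have "real_of_int (24 * M) \<le> real_of_int (100 * int (card B))"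
    using dense unfolding B_def by (rule of_int_le_iff[THEN iffD2])
  then have "0.24 * x \<le> real (card B)" by (simp add: x_def)
  then have "0.0287 * x \<le> real (card B1)"
    by (rule step[OF c1[folded B1_def]]) simp_all
  then have "0.00041 * x \<le> real (card B2)"
    by (rule step[OF c2[folded B2_def]]) simp_all
  then have "0.00000008 * x \<le> real (card B3)"
    by (rule step[OF c3[folded B3_def]]) simp_all
  then have "real (card B3) > 4" using x by simp
  then have card3: "card B3 \<ge> 5" by simp
  define a where "a = Min B3"
  have a: "a \<in> B3" unfolding a_def using card3 finB3 by (intro Min_in) auto
  \<comment> \<open>Besides \<open>a\<close> at least four elements remain, and at most three of
    them would repeat an earlier generator.\<close>
  have "\<not> B3 - {a} \<subseteq> {a + h1, a + h2, a + h3}"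
  proof
    assume "B3 - {a} \<subseteq> {a + h1, a + h2, a + h3}"
    then have "card (B3 - {a}) \<le> card {a + h1, a + h2, a + h3}" by (intro card_mono) auto
    also have "\<dots> \<le> 3" by (simp add: card_insert_if)
    finally show False using card3 a finB3 by simp
  qed
  then obtain a' where a': "a' \<in> B3" "a' \<noteq> a" "a' \<noteq> a + h1" "a' \<noteq> a + h2" "a' \<noteq> a + h3" by auto
  have mem: "2 * e \<in> A" if "e \<in> B" for e using that by (simp add: B_def even_part_def)
  define h4 where "h4 = a' - a"
  have h4: "h4 \<noteq> 0" "h4 \<noteq> h1" "h4 \<noteq> h2" "h4 \<noteq> h3" "a + h4 \<in> B3" using a' by (auto simp: h4_def)
  have cube: "a + h1 \<in> B" "a + h2 \<in> B" "a + h3 \<in> B" "a + h4 \<in> B" "a + h2 + h1 \<in> B"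
    "a + h3 + h1 \<in> B" "a + h4 + h1 \<in> B" "a + h3 + h2 \<in> B" "a + h4 + h2 \<in> B" "a + h4 + h3 \<in> B"
    using a h4(5) by (auto simp: B3_def B2_def B1_def)
  show ?thesis
    by (rule contains_pairwise_sums_5I[of a "a + 2 * h1" "a + 2 * h2" "a + 2 * h3" "a + 2 * h4"])
      (use h1 h2 h3 h4 cube[THEN mem] in \<open>auto simp: algebra_simps\<close>)
qed

text \<open>Three representations \<open>s = u\<^sub>i + v\<^sub>i\<close> with \<open>u\<^sub>i\<close> and \<open>v\<^sub>i\<close> in the halved even part yield four
  numbers whose six pairwise sums are the \<open>2 u\<^sub>i\<close> and \<open>2 v\<^sub>i\<close>.  A fifth number of the opposite
  parity has to avoid only the four translates of the gaps.\<close>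

lemma contains_pairwise_sums_medium:
  fixes m :: int
  assumes m: "m \<ge> 1000000"
    and lower: "m \<le> 40 * int (card (even_part A m))"
    and gaps: "100 * int (card (odd_gaps A 2 m)) \<le> 24 * m"
  shows "contains_pairwise_sums 5 A"
proof -
  define B where "B = even_part A m"
  \<comment> \<open>Thirty blocks of length \<open>L + 1\<close> cover \<open>{1..m}\<close>, so one
    holds at least \<open>m / 1200\<close> elements of \<open>B\<close>. Shifts by at most
    \<open>L\<close> leave about \<open>29 * m / 30\<close> choices of \<open>j\<close>, more than
    the \<open>0.96 * m\<close> that four translates of the gaps can exclude.\<close>
  define L where "L = m div 30"
  have L: "30 * L \<le> m" "m < 30 * (L + 1)" 
    using pos_mod_bound[of 30 m] pos_mod_sign[of 30 m]
    by (simp_all add: L_def minus_div_mult_eq_mod[symmetric] algebra_simps)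
  have L_large: "L \<ge> 33333" using zdiv_mono1[OF m, of 30] by (simp add: L_def)
  define D where "D q = {e \<in> B. e div (L + 1) = q}" for q
  have "\<exists>q. m \<le> 1200 * int (card (D q))"
  proof (rule ccontr)
    assume "\<not> ?thesis"
    then have neg: "1200 * int (card (D q)) < m" for q by (simp add: not_le)
    have "B \<subseteq> (\<Union>q\<in>{0..29}. D q)"
    proof
      fix e assume e: "e \<in> B"
      then have "1 \<le> e" "e \<le> m" by (auto simp: B_def even_part_def)
      then have "e < (L + 1) * 30" using L by simp
      moreover have "(L + 1) * (e div (L + 1)) \<le> e"
        using mult_div_mod_eq[of "L + 1" e] pos_mod_sign[of "L + 1" e] L_large by linarith
      ultimately have "(L + 1) * (e div (L + 1)) < (L + 1) * 30" by (rule order_le_less_trans[rotated])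
      then have "e div (L + 1) < 30" using L_large by (simp only: mult_less_cancel_left)
      moreover have "0 \<le> e div (L + 1)"
        using \<open>1 \<le> e\<close> L_large by (simp add: pos_imp_zdiv_nonneg_iff)
      ultimately show "e \<in> (\<Union>q\<in>{0..29}. D q)" using e by (auto simp: D_def)
    qed
    then have "card B \<le> card (\<Union>q\<in>{0..29}. D q)"
      by (intro card_mono) (auto simp: D_def B_def)
    also have "\<dots> \<le> (\<Sum>q\<in>{0..29}. card (D q))" by (rule card_UN_le) simp
    finally have "int (card B) \<le> (\<Sum>q\<in>{0..29}. int (card (D q)))"
      by (metis of_nat_mono of_nat_sum)
    then have "1200 * int (card B) \<le> (\<Sum>q\<in>{0..29}. 1200 * int (card (D q)))"
      by (simp add: sum_distrib_left[symmetric])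
    also have "\<dots> \<le> (\<Sum>q\<in>{0..29::int}. m - 1)"
      by (intro sum_mono) (simp add: neg)
    finally show False using lower by (simp add: B_def)
  qed
  then obtain q where q: "m \<le> 1200 * int (card (D q))" by blast
  have sub: "D q \<subseteq> {q * (L + 1)..q * (L + 1) + L}"
  proof
    fix e assume "e \<in> D q"
    then have "e div (L + 1) = q" by (simp add: D_def)
    moreover have "0 \<le> e mod (L + 1)" "e mod (L + 1) < L + 1"
      using L_large by (auto intro: pos_mod_sign pos_mod_bound simp del: zle_add1_eq_le)
    ultimately show "e \<in> {q * (L + 1)..q * (L + 1) + L}"
      using div_mult_mod_eq[of e "L + 1"] by auto
  qed
  define d where "d = int (card (D q))"
  have "m \<le> 1200 * d" using q by (simp add: d_def)
  \<comment> \<open>The number of pairs is quadratic in \<open>m\<close> and the number of sums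
    linear; \<open>m \<ge> 1000000\<close> makes \<open>d\<close> exceed 800.\<close>
  then have d: "801 \<le> d" "4 * (2 * L + 1) < 800 * d" using m L by simp_all
  then have "800 * d \<le> (d - 1) * d" by (intro mult_right_mono) simp_all
  with d(2) have big: "4 * (2 * L + 1) < d * (d - 1)" by (simp add: mult.commute)
  obtain s u1 u2 u3 where u: "u1 < u2" "u2 < u3" "2 * u3 < s"
    and uD: "{u1, u2, u3, s - u1, s - u2, s - u3} \<subseteq> D q"
    using exists_three_representations[OF sub _ big[unfolded d_def]] L_large by auto
  have D: "2 * e \<in> A \<and> q * (L + 1) \<le> e \<and> e \<le> q * (L + 1) + L" if "e \<in> D q" for e
    using that sub by (auto simp: D_def B_def even_part_def)
  \<comment> \<open>The four numbers are \<open>b + 2 * \<delta> i\<close> with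
    \<open>b = u1 + u2 + u3 - s\<close>. Adding \<open>b\<close> to the others gives the
    \<open>2 * u\<close>, the remaining pairs give the \<open>2 * (s - u)\<close>, and the fifth
    number \<open>2 * j - 1 - b\<close> gives the odd sums
    \<open>2 * (j + \<delta> i) - 1\<close>.\<close>
  define \<delta> where "\<delta> i = [0, s - u2 - u3, s - u1 - u3, s - u1 - u2] ! i" for i :: nat
  have \<delta>: "\<delta> 0 = 0" "\<delta> 1 = s - u2 - u3" "\<delta> (Suc 0) = s - u2 - u3" "\<delta> 2 = s - u1 - u3" "\<delta> 3 = s - u1 - u2"
    by (simp_all add: \<delta>_def eval_nat_numeral)
  have I: "{..<4} = {0, 1, 2, 3 :: nat}" by auto
  \<comment> \<open>Each nonzero shift has the form \<open>(s - u) - u'\<close> with both terms in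
    the block \<open>D q\<close>, hence is at most \<open>L\<close>.\<close>
  have \<delta>_bounds: "0 \<le> \<delta> i \<and> \<delta> i \<le> L" if "i \<in> {..<4}" for i
    using that u uD D[of u1] D[of u2] D[of u3] D[of "s - u1"] D[of "s - u2"] D[of "s - u3"] L m
    unfolding I by (auto simp: \<delta>)
  have "\<exists>j\<in>{2..m - L}. \<forall>i\<in>{..<4}. j + \<delta> i \<notin> odd_gaps A 2 m"
    by (rule exists_avoiding) (use gaps L m in \<open>auto simp: inj_on_def\<close>)
  then obtain j where j: "j \<in> {2..m - L}" "\<And>i. i \<in> {..<4} \<Longrightarrow> j + \<delta> i \<notin> odd_gaps A 2 m"
    by blast
  have odd: "2 * (j + \<delta> i) - 1 \<in> A" if "i \<in> {..<4}" for i
    using j(1) j(2)[OF that] \<delta>_bounds[OF that] by (auto simp: odd_gaps_def)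
  have evens: "2 * u1 \<in> A" "2 * u2 \<in> A" "2 * u3 \<in> A"
    "2 * (s - u1) \<in> A" "2 * (s - u2) \<in> A" "2 * (s - u3) \<in> A"
    using uD D by blast+
  define b where "b = u1 + u2 + u3 - s"
  show ?thesis
  proof (rule contains_pairwise_sums_5I[of b "b + 2 * \<delta> 1" "b + 2 * \<delta> 2" "b + 2 * \<delta> 3" "2 * j - 1 - b"])
    show "distinct [b, b + 2 * \<delta> 1, b + 2 * \<delta> 2, b + 2 * \<delta> 3, 2 * j - 1 - b]"
    proof -
      have "2 * j - 1 - b \<noteq> b + 2 * x" for x by presburger
      from this[of 0] this[of "\<delta> 1"] this[of "\<delta> 2"] this[of "\<delta> 3"]
      have "2 * j - 1 - b \<notin> {b, b + 2 * \<delta> 1, b + 2 * \<delta> 2, b + 2 * \<delta> 3}" by auto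
      moreover have "0 < \<delta> 3" "\<delta> 3 > \<delta> 2" "\<delta> 2 > \<delta> 1" "\<delta> 1 > 0" using u by (simp_all add: \<delta>)
      ultimately show ?thesis by auto
    qed
  qed (use odd[of 0] odd[of 1] odd[of 2] odd[of 3] evens in \<open>auto simp: \<delta> b_def algebra_simps\<close>)
qed

text \<open>The sums of the first three numbers are 2, \<open>2 Y\<close> and \<open>2 Z\<close>; the last two have the opposite
  parity and sum \<open>2 Z\<close> again, which leaves the parameter \<open>j\<close> free to avoid the gaps.\<close>

lemma contains_pairwise_sums_sparse:
  fixes Y Z :: int
  assumes A: "2 \<in> A" "2 * Y \<in> A" "2 * Z \<in> A" and Y: "1 < Y" and Z: "Y < Z"
    and gaps: "12 * int (card (odd_gaps A 2 (Y + Z))) + 2 < Y"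
  shows "contains_pairwise_sums 5 A"
proof -
  \<comment> \<open>The six odd sums are the numbers \<open>2 * f i j - 1\<close>.\<close>
  define f where "f i j = [j + 1, Y - j + 1, Z - Y + j + 1, Z - j + 1, Z + j, Y + Z - j] ! i"
    for i :: nat and j :: int
  have f: "f 0 j = j + 1" "f 1 j = Y - j + 1" "f (Suc 0) j = Y - j + 1" "f 2 j = Z - Y + j + 1" "f 3 j = Z - j + 1"
    "f 4 j = Z + j" "f 5 j = Y + Z - j" for j
    by (simp_all add: f_def eval_nat_numeral)
  have I: "{..<6} = {0, 1, 2, 3, 4, 5 :: nat}" by auto
  \<comment> \<open>The bound \<open>2 * j < Y\<close> keeps all six indices within
    \<open>{2..Y + Z}\<close> and the last two of the five numbers distinct.\<close>
  have "\<exists>j\<in>{1..(Y - 1) div 2}. \<forall>i\<in>{..<6}. f i j \<notin> odd_gaps A 2 (Y + Z)"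
  proof (rule exists_avoiding)
    show "inj_on (f i) {1..(Y - 1) div 2}" if "i \<in> {..<6}" for i
      using that unfolding I by (auto simp: inj_on_def f)
  qed (use gaps in auto)
  then obtain j where j: "1 \<le> j" "2 * j < Y" "\<And>i. i \<in> {..<6} \<Longrightarrow> f i j \<notin> odd_gaps A 2 (Y + Z)"
    by force
  have odd: "2 * f i j - 1 \<in> A" if "i \<in> {..<6}" for i
  proof -
    have "f i j \<in> {2..Y + Z}"
      using that j(1,2) Y Z unfolding I by (auto simp: f)
    then show ?thesis using j(3)[OF that] by (auto simp: odd_gaps_def)
  qed
  show ?thesis
  proof (rule contains_pairwise_sums_5I[of "1 + Y - Z" "1 + Z - Y" "Y + Z - 1" "Z + Y - 2 * j" "Z - Y + 2 * j"])
    show "distinct [1 + Y - Z, 1 + Z - Y, Y + Z - 1, Z + Y - 2 * j, Z - Y + 2 * j]"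
      using j(1,2) Y Z unfolding distinct.simps list.set by (simp; presburger)
  qed (use A odd[of 0] odd[of 1] odd[of 2] odd[of 3] odd[of 4] odd[of 5]
      in \<open>auto simp: f algebra_simps\<close>)
qed

section \<open>From blocks with positive prefix excess to all sets\<close>

lemma contains_pairwise_sums_prefix:
  fixes h n :: int
  assumes prefix: "\<And>m. 1 \<le> m \<Longrightarrow> m \<le> n \<Longrightarrow> card (odd_gaps A 2 m) < card (even_part A m)"
    and card: "card (even_part A h) \<ge> 59999999" and h: "2 * h \<le> n"
  shows "contains_pairwise_sums 5 A"
proof (rule ccontr)
  assume not: "\<not> ?thesis"
  define P where "P = even_part A h"
  have finP: "finite P" by (simp add: P_def)
  \<comment> \<open>The dense case is excluded, so the evens, and with them the fewer gaps, stay
    below \<open>0.24 * m\<close>; then the medium case must fail by its lower bound.\<close>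
  have few: "40 * int (card (even_part A m)) < m" if "59999997 \<le> m" "m \<le> n" for m
    using that not prefix[of m] contains_pairwise_sums_dense[of m A]
      contains_pairwise_sums_medium[of m A] by force
  have cardP: "card P \<ge> 59999999" using card by (simp add: P_def)
  define Z' where "Z' = Max P"
  define Z where "Z = Max (P - {Z'})"
  define Y where "Y = Max (P - {Z', Z})"
  have Z': "Z' \<in> P" "\<And>e. e \<in> P \<Longrightarrow> e \<le> Z'"
    unfolding Z'_def using cardP finP by (auto intro!: Max_in)
  have c1: "card (P - {Z'}) = card P - 1" using Z' by simp
  have "P - {Z'} \<noteq> {}"
  proof
    assume "P - {Z'} = {}"
    then have "card (P - {Z'}) = 0" by (simp only: card.empty)
    then show False using c1 cardP by linarith
  qed
  then have Z: "Z \<in> P - {Z'}" "\<And>e. e \<in> P - {Z'} \<Longrightarrow> e \<le> Z"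
    using Max_in[of "P - {Z'}"] finP by (simp_all only: Z_def finite_Diff not_False_eq_True Max_ge)
  have c2: "card (P - {Z', Z}) = card P - 2"
    using c1 Z Z' finP by (simp add: card_Diff_subset)
  have "P - {Z', Z} \<noteq> {}"
  proof
    assume "P - {Z', Z} = {}"
    then have "card (P - {Z', Z}) = 0" by (simp only: card.empty)
    then show False using c2 cardP by linarith
  qed
  then have Y: "Y \<in> P - {Z', Z}" "\<And>e. e \<in> P - {Z', Z} \<Longrightarrow> e \<le> Y"
    using Max_in[of "P - {Z', Z}"] finP by (simp_all only: Y_def finite_Diff not_False_eq_True Max_ge)
  have order: "Y < Z" "Z < Z'" using Y Z Z' by force+
  have mem: "2 * e \<in> A \<and> 1 \<le> e \<and> e \<le> h" if "e \<in> P" for e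
    using that by (auto simp: P_def even_part_def)
  have mem_Y: "2 * Y \<in> A" "1 \<le> Y" and mem_Z: "2 * Z \<in> A" "Z \<le> h" and mem_Z': "2 * Z' \<in> A" "Z' \<le> h"
    using mem Y Z Z' by auto
  \<comment> \<open>All but two elements of \<open>P\<close> are at most \<open>Y\<close>, so
    \<open>Y \<ge> 59999999 - 2\<close>, the threshold of the dense case.\<close>
  have "P - {Z', Z} \<subseteq> even_part A Y"
    using Y(2) by (auto simp: P_def even_part_def)
  then have "card P - 2 \<le> card (even_part A Y)"
    unfolding c2[symmetric] by (intro card_mono) auto
  also have "\<dots> \<le> card {1..Y}" by (intro card_mono even_part_subset) auto
  finally have Y_large: "Y \<ge> 59999997" using cardP by simp
  \<comment> \<open>The prefix hypothesis at 1 supplies the sum 2 of the sparse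
    construction.\<close>
  have "card (even_part A 1) > 0" using prefix[of 1] h mem_Z mem_Y order by simp
  then obtain e where "e \<in> even_part A 1" by (metis card_gt_0_iff ex_in_conv)
  then have two: "2 \<in> A" by (cases "e = 1") (auto simp: even_part_def)
  have many: "y \<le> 12 * int (card (even_part A (y + z)))"
    if "2 * y \<in> A" "2 * z \<in> A" "1 < y" "y < z" "y + z \<le> n" for y z
    using contains_pairwise_sums_sparse[OF two that(1-4)] not prefix[of "y + z"] that by force
  \<comment> \<open>From \<open>many\<close> and \<open>few\<close>,
    \<open>40 * y < 12 * (y + z)\<close>, that is \<open>z > 7 * y / 3\<close>.\<close>
  have gap: "2 * y < z"
    if "2 * y \<in> A" "2 * z \<in> A" "Y \<le> y" "y < z" "y + z \<le> n" for y z
    using many[of y z] few[of "y + z"] that Y_large by force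
  have "2 * Y < Z" "2 * Z < Z'"
    using gap mem_Y mem_Z mem_Z' order h by auto
  have "even_part A (Y + Z) \<subseteq> insert Z (even_part A Y)"
  proof
    fix e assume e: "e \<in> even_part A (Y + Z)"
    then have "e \<in> P" "e \<noteq> Z'"
      using \<open>2 * Z < Z'\<close> mem_Z' order by (auto simp: P_def even_part_def)
    then show "e \<in> insert Z (even_part A Y)"
      using Y(2)[of e] e by (auto simp: even_part_def)
  qed
  then have "card (even_part A (Y + Z)) \<le> card (insert Z (even_part A Y))"
    by (intro card_mono) auto
  also have "\<dots> \<le> Suc (card (even_part A Y))" by (rule card_insert_le_m1) auto
  finally have "card (even_part A (Y + Z)) \<le> Suc (card (even_part A Y))" .
  \<comment> \<open>Now \<open>Y\<close> is at most 12 times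
    \<open>card (even_part A Y) + 1\<close>, which is below \<open>Y / 40 + 1\<close>; impossible
    for large \<open>Y\<close>.\<close>
  then show False
    using many[of Y Z] few[of Y] mem_Y mem_Z order h Y_large by force
qed

text \<open>Reflection in \<open>n + 1\<close> preserves parity but shifts the pairing of evens with odds, which is
  why the gaps of a prefix are only counted from index 2 on in the previous lemmas.\<close>

lemma contains_pairwise_sums_minimal:
  fixes n :: int
  assumes prefix: "\<And>m. 1 \<le> m \<Longrightarrow> m \<le> n \<Longrightarrow> card (odd_gaps A 1 m) < card (even_part A m)"
    and suffix: "\<And>m. 0 \<le> m \<Longrightarrow> m < n \<Longrightarrow>
      card {k \<in> {m + 1..n}. 2 * k - 1 \<notin> A} < card {e \<in> {m + 1..n}. 2 * e \<in> A}"
    and card: "card (even_part A n) \<ge> 119999999"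
  shows "contains_pairwise_sums 5 A"
proof -
  define h where "h = n div 2"
  define A' where "A' = {a. 2 * (n + 1) - a \<in> A}"
  have h: "2 * h \<le> n" "n \<le> 2 * h + 1" unfolding h_def by linarith+
  have refl_even: "card (even_part A' m) = card {e \<in> {n - m + 1..n}. 2 * e \<in> A}" for m
    by (rule bij_betw_same_card[of "\<lambda>e. n + 1 - e"], rule bij_betw_byWitness[where f' = "\<lambda>e. n + 1 - e"])
      (auto simp: even_part_def A'_def algebra_simps)
  have refl_odd: "card (odd_gaps A' 2 m) = card {k \<in> {n - m + 2..n}. 2 * k - 1 \<notin> A}" for m
    by (rule bij_betw_same_card[of "\<lambda>k. n + 2 - k"], rule bij_betw_byWitness[where f' = "\<lambda>k. n + 2 - k"])
      (auto simp: odd_gaps_def A'_def algebra_simps)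
  \<comment> \<open>For odd \<open>n\<close> the middle index \<open>h + 1\<close> lies in neither
    half, whence \<open>119999999 = 2 * 59999999 + 1\<close>.\<close>
  have "even_part A n \<subseteq> even_part A h \<union> insert (h + 1) {e \<in> {n - h + 1..n}. 2 * e \<in> A}"
    using h by (auto simp: even_part_def)
  then have "card (even_part A n) \<le> card (even_part A h \<union> insert (h + 1) {e \<in> {n - h + 1..n}. 2 * e \<in> A})"
    by (intro card_mono) auto
  also have "\<dots> \<le> card (even_part A h) + card (insert (h + 1) {e \<in> {n - h + 1..n}. 2 * e \<in> A})"
    by (rule card_Un_le)
  also have "card (insert (h + 1) {e \<in> {n - h + 1..n}. 2 * e \<in> A}) \<le> Suc (card (even_part A' h))"
    unfolding refl_even by (rule card_insert_le_m1) auto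
  finally consider "card (even_part A h) \<ge> 59999999" | "card (even_part A' h) \<ge> 59999999"
    using card by linarith
  then show ?thesis
  proof cases
    case 1
    have "card (odd_gaps A 2 m) \<le> card (odd_gaps A 1 m)" for m
      by (rule card_mono) (auto simp: odd_gaps_def)
    then show ?thesis
      using contains_pairwise_sums_prefix[OF _ 1 h(1)] prefix le_less_trans by blast
  next
    case 2
    have "contains_pairwise_sums 5 A'"
    proof (rule contains_pairwise_sums_prefix[OF _ 2 h(1)])
      fix m assume m: "1 \<le> m" "m \<le> n"
      have "card (odd_gaps A' 2 m) \<le> card {k \<in> {n - m + 1..n}. 2 * k - 1 \<notin> A}"
        unfolding refl_odd by (rule card_mono) auto
      also have "\<dots> < card (even_part A' m)"
        unfolding refl_even using suffix[of "n - m"] m by simp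
      finally show "card (odd_gaps A' 2 m) < card (even_part A' m)" .
    qed
    then show ?thesis unfolding A'_def by (rule contains_pairwise_sums_reflect)
  qed
qed

text \<open>Descent to a shortest block: a proper prefix or, after translation, a proper suffix of
  large excess is handled by induction.\<close>

lemma contains_pairwise_sums_excess:
  fixes n :: nat
  assumes "card (even_part A (int n)) \<ge> card (odd_gaps A 1 (int n)) + 119999999"
  shows "contains_pairwise_sums 5 A"
  using assms
proof (induction n arbitrary: A rule: less_induct)
  case (less n)
  show ?case
  proof (cases "\<exists>m<n. card (even_part A (int m)) \<ge> card (odd_gaps A 1 (int m)) + 119999999")
    case True
    then show ?thesis using less.IH by blast
  next
    case no_prefix: False
    define E G where "E m = {e \<in> {int m + 1..int n}. 2 * e \<in> A}"
      and "G m = {k \<in> {int m + 1..int n}. 2 * k - 1 \<notin> A}" for m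
    have E: "card (even_part A (int n)) = card (even_part A (int m)) + card (E m)" if "m \<le> n" for m
    proof -
      have "even_part A (int n) = even_part A (int m) \<union> E m"
        using that by (auto simp: even_part_def E_def)
      moreover have "even_part A (int m) \<inter> E m = {}" by (auto simp: even_part_def E_def)
      ultimately show ?thesis by (simp add: card_Un_disjoint E_def)
    qed
    have G: "card (odd_gaps A 1 (int n)) = card (odd_gaps A 1 (int m)) + card (G m)" if "m \<le> n" for m
    proof -
      have "odd_gaps A 1 (int n) = odd_gaps A 1 (int m) \<union> G m"
        using that by (auto simp: odd_gaps_def G_def)
      moreover have "odd_gaps A 1 (int m) \<inter> G m = {}" by (auto simp: odd_gaps_def G_def)
      ultimately show ?thesis by (simp add: card_Un_disjoint G_def)
    qed
    have suffix_case: "contains_pairwise_sums 5 A"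
      if "0 < m" "m \<le> n" "card (E m) \<ge> card (G m) + 119999999" for m
    proof -
      define A' where "A' = {a. a + 2 * int m \<in> A}"
      have "card (even_part A' (int (n - m))) = card (E m)"
        by (rule bij_betw_same_card[of "\<lambda>e. e + int m"], rule bij_betw_byWitness[where f' = "\<lambda>e. e - int m"])
          (use that(2) in \<open>auto simp: even_part_def E_def A'_def algebra_simps\<close>)
      moreover have "card (odd_gaps A' 1 (int (n - m))) = card (G m)"
        by (rule bij_betw_same_card[of "\<lambda>e. e + int m"], rule bij_betw_byWitness[where f' = "\<lambda>e. e - int m"])
          (use that(2) in \<open>auto simp: odd_gaps_def G_def A'_def algebra_simps\<close>)
      ultimately have "contains_pairwise_sums 5 A'"
        using that by (intro less.IH[of "n - m"]) auto
      then show ?thesis unfolding A'_def by (rule contains_pairwise_sums_translate)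
    qed
    show ?thesis
    proof (cases "\<exists>m. 0 < m \<and> m \<le> n \<and> card (E m) \<ge> card (G m) + 119999999")
      case True
      then show ?thesis using suffix_case by blast
    next
      case no_suffix: False
      show ?thesis
      proof (rule contains_pairwise_sums_minimal[of "int n"])
        fix i :: int assume i: "1 \<le> i" "i \<le> int n"
        define m where "m = nat i"
        have m: "i = int m" "0 < m" "m \<le> n" using i by (simp_all add: m_def)
        \<comment> \<open>The suffix carries less than the total excess of the block, so the prefix
          before it has positive excess; the other case is symmetric.\<close>
        have "\<not> card (E m) \<ge> card (G m) + 119999999"
          using no_suffix m(2,3) by blast
        then show "card (odd_gaps A 1 i) < card (even_part A i)"
          using E[of m] G[of m] less.prems m by simp
      next
        fix i :: int assume i: "0 \<le> i" "i < int n"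
        obtain m where m: "i = int m" using i(1) nonneg_int_cases by blast
        have "card (even_part A (int m)) < card (odd_gaps A 1 (int m)) + 119999999"
          using no_prefix i m by auto
        then have "card (G m) < card (E m)"
          using E[of m] G[of m] less.prems i m by simp
        then show "card {k \<in> {i + 1..int n}. 2 * k - 1 \<notin> A} < card {e \<in> {i + 1..int n}. 2 * e \<in> A}"
          by (simp add: E_def G_def m)
      qed (use less.prems in simp)
    qed
  qed
qed

text \<open>The odd members of \<open>A\<close> number \<open>n\<close> minus the odd gaps, so the
  surplus of \<open>card A\<close> over \<open>n\<close> is the excess of evens over gaps.\<close>

lemma sums_threshold_5: "sums_threshold 5 n 119999999"
  unfolding sums_threshold_def
proof (intro allI impI)
  fix A :: "int set"
  assume A: "A \<subseteq> {1..2 * int n}" and card: "int n + 119999999 \<le> int (card A)"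
  define K where "K = {k \<in> {1..int n}. 2 * k - 1 \<in> A}"
  have "A \<subseteq> (\<lambda>e. 2 * e) ` even_part A (int n) \<union> (\<lambda>k. 2 * k - 1) ` K"
  proof
    fix a assume a: "a \<in> A"
    then have r: "1 \<le> a" "a \<le> 2 * int n" using A by auto
    show "a \<in> (\<lambda>e. 2 * e) ` even_part A (int n) \<union> (\<lambda>k. 2 * k - 1) ` K"
    proof (cases "even a")
      case True
      then obtain e where "a = 2 * e" by blast
      then show ?thesis using a r by (auto simp: even_part_def)
    next
      case False
      then obtain k where "a = 2 * k + 1" by (rule oddE)
      then have "a = 2 * (k + 1) - 1" by simp
      moreover from this have "k + 1 \<in> K" using a r by (auto simp: K_def)
      ultimately show ?thesis by blast
    qed
  qed
  then have "card A \<le> card ((\<lambda>e. 2 * e) ` even_part A (int n) \<union> (\<lambda>k. 2 * k - 1) ` K)"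
    by (intro card_mono) (auto simp: K_def)
  also have "\<dots> \<le> card ((\<lambda>e. 2 * e) ` even_part A (int n)) + card ((\<lambda>k. 2 * k - 1) ` K)"
    by (rule card_Un_le)
  also have "\<dots> \<le> card (even_part A (int n)) + card K"
    by (intro add_mono card_image_le) (auto simp: K_def)
  finally have "card A \<le> card (even_part A (int n)) + card K" .
  moreover have "card K + card (odd_gaps A 1 (int n)) = n"
  proof -
    have "K \<union> odd_gaps A 1 (int n) = {1..int n}" "K \<inter> odd_gaps A 1 (int n) = {}"
      by (auto simp: K_def odd_gaps_def)
    moreover have "finite K" by (simp add: K_def)
    ultimately show ?thesis
      using card_Un_disjoint[of K "odd_gaps A 1 (int n)"] by simp
  qed
  ultimately show "contains_pairwise_sums 5 A"
    using card by (intro contains_pairwise_sums_excess[where n = n]) linarith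
qed

theorem theorem9:
  fixes n :: nat
  assumes "n \<ge> 1"
  shows "real_of_int (g_sums 5 n) < 1.2 * 10 ^ 8 \<and>
    (\<forall>A :: int set. A \<subseteq> {1..2 * int n} \<and> real (card A) \<ge> real n + 1.2 * 10 ^ 8 \<longrightarrow>
       contains_pairwise_sums 5 A)"
proof (intro conjI allI impI)
  have "g_sums 5 n \<le> 119999999"
    by (rule g_sums_least(2)) (simp_all add: sums_threshold_5)
  then show "real_of_int (g_sums 5 n) < 1.2 * 10 ^ 8" by simp
next
  fix A :: "int set"
  assume A: "A \<subseteq> {1..2 * int n} \<and> real (card A) \<ge> real n + 1.2 * 10 ^ 8"
  then have "int (card A) \<ge> int n + 119999999" by simp
  with A show "contains_pairwise_sums 5 A"
    using sums_threshold_5[of n] unfolding sums_threshold_def by blast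
qed

end
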